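(* Let $\alpha\in(1,2)$ and let $N,N_1,N_2,N_3$ satisfy $1\le N_j\le N$ for $j\in\{1,2,3\}$. With $S$ as in the context, the following counting estimates hold, with implicit constants independent of $N,N_1,N_2,N_3$, of $m$, and of the fixed frequencies: $$|S_{kk_1}|\lesssim\frac{(N_2\wedge N_3)^{3-\alpha}}{\langle k-k_1\rangle}+N_2\wedge N_3,\qquad|S_{kk_3}|\lesssim\frac{(N_1\wedge N_2)^{3-\alpha}}{\langle k-k_3\rangle}+N_1\wedge N_2,$$ $$|S_{k_1k_2}|\lesssim\frac{N_3^{3-\alpha}}{\langle k_1-k_2\rangle}+N_3,\qquad|S_{k_2k_3}|\lesssim\frac{N_1^{3-\alpha}}{\langle k_2-k_3\rangle}+N_1 .$$
   Context: $\langle x\rangle=(1+|x|^2)^{1/2}$, $a\wedge b=\min\{a,b\}$; $N,N_j$ are dyadic numbers. For a real parameter $m$, $S$ is the set of $(k,k_1,k_2,k_3)\in(\mathbb Z^2)^4$ such that $$k_1-k_2+k_3-k=0,\quad k_2\notin\{k_1,k_3\},\quad|k_1|^\alpha-|k_2|^\alpha+|k_3|^\alpha-|k|^\alpha=m+\mathcal O(1),\quad|k|\le N,\ |k_j|\le N_j\ (j=1,2,3),$$ where $\mathcal O(1)$ means bounded in absolute value by a fixed absolute constant. A subscript indicates fixed variables: e.g. $S_{kk_1}$ is the set of elements of $S$ with prescribed values of $k$ and $k_1$, and $|S_{kk_1}|$ its cardinality. *)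

theory Defs
  imports "HOL-Analysis.Analysis"
begin

text \<open>Points of the lattice $\mathbb{Z}^2$ are pairs of integers with componentwise
  addition and subtraction.  The norm on \<^typ>\<open>real \<times> real\<close> is the Euclidean one.\<close>

type_synonym lattice = "int \<times> int"

definition lnorm :: "lattice \<Rightarrow> real" where
  "lnorm k = norm (real_of_int (fst k), real_of_int (snd k))"

definition bracket :: "lattice \<Rightarrow> real" where
  "bracket k = (1 + (lnorm k)\<^sup>2) powr (1 / 2)"

definition dyadic :: "real \<Rightarrow> bool" where
  "dyadic x \<longleftrightarrow> (\<exists>n::int. x = 2 powi n)"

text \<open>The parameter \<open>B\<close> is the constant bounding the $\mathcal{O}(1)$ term.\<close>

definition res_set ::
  "real \<Rightarrow> real \<Rightarrow> real \<Rightarrow> real \<Rightarrow> real \<Rightarrow> real \<Rightarrow> real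
    \<Rightarrow> (lattice \<times> lattice \<times> lattice \<times> lattice) set" where
  "res_set \<alpha> B m N N1 N2 N3 =
    {(k, k1, k2, k3).
      k1 - k2 + k3 - k = 0 \<and> k2 \<notin> {k1, k3} \<and>
      \<bar>lnorm k1 powr \<alpha> - lnorm k2 powr \<alpha> + lnorm k3 powr \<alpha> - lnorm k powr \<alpha> - m\<bar> \<le> B \<and>
      lnorm k \<le> N \<and> lnorm k1 \<le> N1 \<and> lnorm k2 \<le> N2 \<and> lnorm k3 \<le> N3}"

text \<open>The following lemmas ensure that the cardinality of (a subset of)
  \<^const>\<open>res_set\<close> is never the default value \<open>0\<close> for infinite sets.\<close>

lemma finite_lnorm_le: "finite {k. lnorm k \<le> R}"
proof (rule finite_subset)
  show "{k. lnorm k \<le> R} \<subseteq> {- \<lceil>R\<rceil>..\<lceil>R\<rceil>} \<times> {- \<lceil>R\<rceil>..\<lceil>R\<rceil>}"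
  proof
    fix k assume "k \<in> {k. lnorm k \<le> R}"
    then have R: "lnorm k \<le> R" by simp
    have "\<bar>real_of_int (fst k)\<bar> \<le> lnorm k" "\<bar>real_of_int (snd k)\<bar> \<le> lnorm k"
      using norm_fst_le[of "real_of_int (fst k)" "real_of_int (snd k)"]
        norm_snd_le[of "real_of_int (snd k)" "real_of_int (fst k)"]
      by (simp_all add: lnorm_def)
    then have "\<bar>fst k\<bar> \<le> \<lceil>R\<rceil>" "\<bar>snd k\<bar> \<le> \<lceil>R\<rceil>"
      using R by linarith+
    then show "k \<in> {- \<lceil>R\<rceil>..\<lceil>R\<rceil>} \<times> {- \<lceil>R\<rceil>..\<lceil>R\<rceil>}"
      by (auto simp: mem_Times_iff)
  qed
qed simp

lemma finite_res_set: "finite (res_set \<alpha> B m N N1 N2 N3)"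
  by (rule finite_subset[where B = "{k. lnorm k \<le> N} \<times> {k. lnorm k \<le> N1} \<times>
        {k. lnorm k \<le> N2} \<times> {k. lnorm k \<le> N3}"])
    (auto simp: res_set_def finite_lnorm_le)

end

theory Submission
  imports Defs
begin

text \<open>Prescribing two adjacent frequencies leaves one free lattice point \<open>x\<close>, and the
  resonance condition becomes \<open>|x|\<^sup>\<alpha> - |x - a|\<^sup>\<alpha> = m' + O(1)\<close> with \<open>a \<noteq> 0\<close> fixed.
  Replacing \<open>|x|\<^sup>\<alpha>\<close> by the smooth function \<open>g x = (1 + |x|\<^sup>2) powr (\<alpha>/2)\<close> costs only \<open>O(1)\<close>.
  The Hessian of \<open>g\<close> is comparable to \<open>(1 + |x|\<^sup>2) powr (\<alpha>/2 - 1)\<close> times the identity, so a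
  lattice vector \<open>v\<close> obtained by rounding a large constant multiple of \<open>a/|a|\<close> satisfies
  \<open>v \<bullet> Hess g a \<ge> |a| (1 + |x|\<^sup>2) powr (\<alpha>/2 - 1)\<close>.  Hence \<open>g x - g (x - a)\<close> increases at this
  rate along each of the \<open>O(R)\<close> lines in direction \<open>v\<close> which cover the lattice points of a disc
  of radius \<open>R\<close>.\<close>

section \<open>Growth of the smoothed difference along a line\<close>

text \<open>Up to the factor \<open>\<alpha> * (1 + y \<bullet> y) powr (\<alpha> / 2 - 1)\<close>,
  the right-hand side is the Hessian of \<open>g\<close> at \<open>y\<close> applied to
  \<open>a\<close> and \<open>v\<close>. The part of \<open>v\<close> along \<open>a\<close>
  contributes at least \<open>3 / (\<alpha> - 1) * (1 - (2 - \<alpha>)) = 3\<close> times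
  \<open>norm a\<close>; the remainder \<open>u\<close> costs at most \<open>norm a\<close> in each
  of the two terms. The constant 3 is chosen so that one \<open>norm a\<close> survives.\<close>

lemma hessian_form_ge:
  fixes a u v y :: "'a::real_inner"
  assumes \<alpha>: "1 < \<alpha>" "\<alpha> < 2" and a: "a \<noteq> 0" and u: "norm u \<le> 1"
    and v: "v = (3 / (\<alpha> - 1) / norm a) *\<^sub>R a + u"
  shows "norm a \<le> a \<bullet> v - (2 - \<alpha>) * (y \<bullet> a) * (y \<bullet> v) / (1 + y \<bullet> y)"
proof -
  define W M where "W = 1 + y \<bullet> y" and "M = 3 / (\<alpha> - 1)"
  have W: "W > 0" "(norm y)\<^sup>2 \<le> W"
    by (auto simp: W_def power2_norm_eq_inner add_pos_nonneg)
  have M: "M > 0" "M * (\<alpha> - 1) = 3"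
    using \<alpha> nonzero_eq_divide_eq[of "\<alpha> - 1" M 3]
    by (simp_all add: M_def del: left_diff_distrib_numeral right_diff_distrib_numeral)
  have na: "norm a > 0" using a by simp
  have av: "a \<bullet> v = M * norm a + a \<bullet> u"
    using na by (simp add: v inner_add_right M_def[symmetric] power2_norm_eq_inner[symmetric]
        power2_eq_square)
  have au: "a \<bullet> u \<ge> - norm a"
  proof -
    have "\<bar>a \<bullet> u\<bar> \<le> norm a * norm u" by (rule Cauchy_Schwarz_ineq2)
    also have "\<dots> \<le> norm a" using u by (simp add: mult_left_le)
    finally show ?thesis by linarith
  qed
  have yv: "(y \<bullet> a) * (y \<bullet> v) = M / norm a * (y \<bullet> a)\<^sup>2 + (y \<bullet> a) * (y \<bullet> u)"
    by (simp add: v inner_add_right M_def[symmetric] power2_eq_square algebra_simps)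
  have ya: "\<bar>y \<bullet> a\<bar> \<le> norm y * norm a" by (rule Cauchy_Schwarz_ineq2)
  have "M / norm a * (y \<bullet> a)\<^sup>2 \<le> M * norm a * W"
  proof -
    have "(y \<bullet> a)\<^sup>2 \<le> (norm y * norm a)\<^sup>2"
      using ya by (rule power2_le_iff_abs_le[THEN iffD2, rotated]) simp
    also have "\<dots> \<le> W * (norm a)\<^sup>2" using W by (simp add: power_mult_distrib mult_right_mono)
    finally have "M / norm a * (y \<bullet> a)\<^sup>2 \<le> M / norm a * (W * (norm a)\<^sup>2)"
      using M na by (intro mult_left_mono) auto
    then show ?thesis using na by (simp add: power2_eq_square field_simps)
  qed
  moreover have "(y \<bullet> a) * (y \<bullet> u) \<le> norm a * W"
  proof -
    have "\<bar>y \<bullet> u\<bar> \<le> norm y * norm u" by (rule Cauchy_Schwarz_ineq2)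
    also have "\<dots> \<le> norm y" using u by (simp add: mult_left_le)
    finally have "\<bar>(y \<bullet> a) * (y \<bullet> u)\<bar> \<le> (norm y * norm a) * norm y"
      using ya by (simp only: abs_mult) (intro mult_mono, auto)
    also have "\<dots> = norm a * (norm y)\<^sup>2" by (simp add: power2_eq_square)
    also have "\<dots> \<le> norm a * W" using W na by (intro mult_left_mono) auto
    finally show ?thesis by linarith
  qed
  ultimately have "(y \<bullet> a) * (y \<bullet> v) \<le> (M * norm a + norm a) * W"
    unfolding yv by (simp add: algebra_simps)
  then have "(y \<bullet> a) * (y \<bullet> v) / W \<le> M * norm a + norm a"
    using W by (simp add: pos_divide_le_eq)
  then have "(2 - \<alpha>) * ((y \<bullet> a) * (y \<bullet> v) / W) \<le> (2 - \<alpha>) * (M * norm a + norm a)"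
    using \<alpha> by (intro mult_left_mono) auto
  \<comment> \<open>Writing \<open>2 - \<alpha>\<close> as \<open>1 - (\<alpha> - 1)\<close> and
    using \<open>M * (\<alpha> - 1) = 3\<close> produces the gain of
    \<open>3 * norm a\<close>.\<close>
  moreover have "(2 - \<alpha>) * (M * norm a + norm a) = M * norm a - 3 * norm a + (2 - \<alpha>) * norm a"
  proof -
    have "(M * (\<alpha> - 1)) * norm a = 3 * norm a" unfolding M(2) ..
    then show ?thesis by (simp add: algebra_simps)
  qed
  moreover have "(2 - \<alpha>) * norm a \<le> norm a" using \<alpha> na by simp
  ultimately have "(2 - \<alpha>) * ((y \<bullet> a) * (y \<bullet> v) / W) \<le> M * norm a - 2 * norm a" by linarith
  then show ?thesis using av au by (simp add: W_def[symmetric] mult.assoc)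
qed

text \<open>The exponent is left free because the formula serves twice:
  \<open>p = \<alpha> / 2\<close> differentiates \<open>g\<close> along \<open>v\<close>, and
  \<open>p = \<alpha> / 2 - 1\<close> differentiates the resulting gradient along
  \<open>a\<close>.\<close>

lemma has_real_derivative_bracket_line:
  fixes z a :: "'a::real_inner"
  shows "((\<lambda>s. (1 + (z + s *\<^sub>R a) \<bullet> (z + s *\<^sub>R a)) powr p) has_real_derivative
      2 * p * (1 + (z + s *\<^sub>R a) \<bullet> (z + s *\<^sub>R a)) powr (p - 1) * ((z + s *\<^sub>R a) \<bullet> a)) (at s)"
proof -
  have eq: "(\<lambda>s. 1 + (z + s *\<^sub>R a) \<bullet> (z + s *\<^sub>R a)) =
      (\<lambda>s. 1 + z \<bullet> z + 2 * s * (z \<bullet> a) + s\<^sup>2 * (a \<bullet> a))"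
    by (simp add: inner_simps inner_commute power2_eq_square algebra_simps)
  have "((\<lambda>s. 1 + (z + s *\<^sub>R a) \<bullet> (z + s *\<^sub>R a)) has_real_derivative
      2 * ((z + s *\<^sub>R a) \<bullet> a)) (at s)"
    unfolding eq by (auto intro!: derivative_eq_intros simp: inner_simps algebra_simps)
  from DERIV_fun_powr[OF this, of p] show ?thesis
    by (simp add: add_pos_nonneg mult_ac)
qed

text \<open>Two mean value theorems, first along \<open>v\<close> and then along \<open>a\<close>,
  turn \<open>F t - F s\<close> into \<open>t - s\<close> times a mixed second derivative of
  \<open>g\<close> at a single point. That point has norm at most \<open>R + norm a\<close>, which
  bounds the Hessian from below.\<close>

lemma bracket_difference_growth:
  fixes x a u v :: "'a::real_inner"
  assumes \<alpha>: "1 < \<alpha>" "\<alpha> < 2" and a: "a \<noteq> 0" and u: "norm u \<le> 1"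
    and v: "v = (3 / (\<alpha> - 1) / norm a) *\<^sub>R a + u"
    and st: "s < t" and R: "norm (x + s *\<^sub>R v) \<le> R" "norm (x + t *\<^sub>R v) \<le> R"
  defines "F \<equiv> \<lambda>t. (1 + (x + t *\<^sub>R v) \<bullet> (x + t *\<^sub>R v)) powr (\<alpha> / 2) -
      (1 + (x - a + t *\<^sub>R v) \<bullet> (x - a + t *\<^sub>R v)) powr (\<alpha> / 2)"
  shows "(t - s) * (norm a * (R + norm a + 1) powr (\<alpha> - 2)) \<le> F t - F s"
proof -
  \<comment> \<open>\<open>\<alpha> * h y\<close> is the derivative of \<open>g\<close> at
    \<open>y\<close> in the direction \<open>v\<close>.\<close>
  define h where "h y = (1 + y \<bullet> y) powr (\<alpha> / 2 - 1) * (y \<bullet> v)" for y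
  have "(F has_real_derivative \<alpha> * (h (x + t *\<^sub>R v) - h (x - a + t *\<^sub>R v))) (at t)" for t
    unfolding F_def
    by (rule derivative_eq_intros has_real_derivative_bracket_line refl)+
      (simp add: h_def algebra_simps)
  then obtain r where r: "s < r" "r < t"
    and Fr: "F t - F s = (t - s) * (\<alpha> * (h (x + r *\<^sub>R v) - h (x - a + r *\<^sub>R v)))"
    using MVT2[OF st, of F "\<lambda>t. \<alpha> * (h (x + t *\<^sub>R v) - h (x - a + t *\<^sub>R v))"] by blast
  define z where "z = x - a + r *\<^sub>R v"
  \<comment> \<open>The mean value point \<open>z + a = x + r *\<^sub>R v\<close> lies between two
    points of the ball of radius \<open>R\<close>, which is convex.\<close>
  have zR: "norm (z + a) \<le> R"
  proof -
    define l where "l = (r - s) / (t - s)"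
    have l: "0 \<le> l" "l \<le> 1" "r = s + l * (t - s)"
      using st r by (simp_all add: l_def)
    have "x + r *\<^sub>R v = (1 - l) *\<^sub>R (x + s *\<^sub>R v) + l *\<^sub>R (x + t *\<^sub>R v)"
      unfolding l(3) by (simp add: algebra_simps)
    then have "x + r *\<^sub>R v \<in> closed_segment (x + s *\<^sub>R v) (x + t *\<^sub>R v)"
      unfolding in_segment using l(1,2) by blast
    moreover have "closed_segment (x + s *\<^sub>R v) (x + t *\<^sub>R v) \<subseteq> cball 0 R"
      using R by (intro closed_segment_subset) auto
    ultimately have "x + r *\<^sub>R v \<in> cball 0 R" by (rule rev_subsetD)
    then show ?thesis by (simp add: z_def)
  qed
  define W where "W \<sigma> = 1 + (z + \<sigma> *\<^sub>R a) \<bullet> (z + \<sigma> *\<^sub>R a)" for \<sigma>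
  \<comment> \<open>The derivative of \<open>h\<close> on the way from \<open>z\<close> to
    \<open>z + a\<close>, with the power of \<open>W\<close> factored out so that the bracket is the
    expression in \<open>hessian_form_ge\<close>.\<close>
  define h' where "h' \<sigma> = W \<sigma> powr (\<alpha> / 2 - 1) *
      (a \<bullet> v - (2 - \<alpha>) * ((z + \<sigma> *\<^sub>R a) \<bullet> a) * ((z + \<sigma> *\<^sub>R a) \<bullet> v) / W \<sigma>)" for \<sigma>
  have W: "W \<sigma> > 0" for \<sigma> by (simp add: W_def add_pos_nonneg)
  have "((\<lambda>\<sigma>. h (z + \<sigma> *\<^sub>R a)) has_real_derivative h' \<sigma>) (at \<sigma>)" for \<sigma>
  proof -
    have "((\<lambda>\<sigma>. (z + \<sigma> *\<^sub>R a) \<bullet> v) has_real_derivative a \<bullet> v) (at \<sigma>)"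
      by (auto intro!: derivative_eq_intros simp: inner_simps)
    note DERIV_mult[OF has_real_derivative_bracket_line[of z a "\<alpha> / 2 - 1" \<sigma>] this]
    moreover have "W \<sigma> powr (\<alpha> / 2 - 1 - 1) = W \<sigma> powr (\<alpha> / 2 - 1) / W \<sigma>"
      using W by (metis less_imp_le powr_diff powr_one)
    ultimately show ?thesis
      unfolding h_def h'_def W_def[symmetric]
      by (elim DERIV_cong) (simp only:, simp add: algebra_simps diff_divide_distrib add_divide_distrib)
  qed
  then obtain \<sigma> where \<sigma>: "0 < \<sigma>" "\<sigma> < 1" and h\<sigma>: "h (z + 1 *\<^sub>R a) - h (z + 0 *\<^sub>R a) = (1 - 0) * h' \<sigma>"
    using MVT2[of 0 1 "\<lambda>\<sigma>. h (z + \<sigma> *\<^sub>R a)" h'] by auto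
  define \<rho> where "\<rho> = R + norm a + 1"
  have "0 \<le> R" using R norm_ge_zero order_trans by blast
  then have \<rho>: "\<rho> > 0" by (simp add: \<rho>_def add_nonneg_pos)
  have "norm (z + \<sigma> *\<^sub>R a) \<le> norm (z + a) + norm ((1 - \<sigma>) *\<^sub>R a)"
    using norm_triangle_ineq4[of "z + a" "(1 - \<sigma>) *\<^sub>R a"] by (simp add: algebra_simps)
  also have "norm ((1 - \<sigma>) *\<^sub>R a) \<le> norm a"
    using \<sigma> by (simp add: mult_left_le_one_le)
  finally have "norm (z + \<sigma> *\<^sub>R a) \<le> R + norm a" using zR by linarith
  then have "(norm (z + \<sigma> *\<^sub>R a))\<^sup>2 \<le> (R + norm a)\<^sup>2" by (intro power_mono) auto
  then have "W \<sigma> \<le> \<rho>\<^sup>2"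
    using \<open>0 \<le> R\<close> by (simp add: W_def \<rho>_def power2_norm_eq_inner power2_sum[of _ 1])
      (rule add_increasing2, auto)
  \<comment> \<open>The exponent \<open>\<alpha> / 2 - 1\<close> is negative, so the upper bound on
    \<open>W \<sigma>\<close> becomes a lower bound on its power.\<close>
  then have "(\<rho>\<^sup>2) powr (\<alpha> / 2 - 1) \<le> W \<sigma> powr (\<alpha> / 2 - 1)"
    using W \<alpha> by (intro powr_mono2') auto
  also have "(\<rho>\<^sup>2) powr (\<alpha> / 2 - 1) = \<rho> powr (\<alpha> - 2)"
    using \<rho> by (simp add: powr_powr flip: powr_numeral)
  finally have "norm a * \<rho> powr (\<alpha> - 2) \<le> h' \<sigma>"
    using hessian_form_ge[OF \<alpha> a u v, of "z + \<sigma> *\<^sub>R a"]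
    unfolding h'_def W_def[symmetric] by (subst mult.commute) (intro mult_mono, auto)
  also have "\<dots> \<le> \<alpha> * h' \<sigma>"
  proof -
    have "0 \<le> h' \<sigma>" using calculation by (rule order_trans[rotated]) simp
    then show ?thesis using \<alpha> by (simp add: mult_le_cancel_right1)
  qed
  finally have "norm a * \<rho> powr (\<alpha> - 2) \<le> \<alpha> * (h (x + r *\<^sub>R v) - h (x - a + r *\<^sub>R v))"
    using h\<sigma> by (simp add: z_def algebra_simps)
  then show ?thesis
    unfolding Fr \<rho>_def using st by (intro mult_left_mono) auto
qed

section \<open>The cost of smoothing\<close>

text \<open>The first bound is monotonicity. For the second,
  \<open>(1 + T) powr (\<alpha> / 2)\<close> splits as \<open>w + T * w\<close>, where
  \<open>w\<close> carries a negative exponent: hence \<open>w \<le> 1\<close>, and replacing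
  \<open>1 + T\<close> by \<open>T\<close> inside \<open>w\<close> only increases it.\<close>

lemma powr_bracket_diff_bounds:
  fixes y :: "'a::real_inner"
  assumes "0 < \<alpha>" "\<alpha> < 2"
  shows "norm y powr \<alpha> \<le> (1 + y \<bullet> y) powr (\<alpha> / 2)" "(1 + y \<bullet> y) powr (\<alpha> / 2) \<le> norm y powr \<alpha> + 1"
proof -
  have eq: "norm y powr \<alpha> = (y \<bullet> y) powr (\<alpha> / 2)"
    by (simp add: norm_eq_sqrt_inner powr_half_sqrt[symmetric] powr_powr)
  show "norm y powr \<alpha> \<le> (1 + y \<bullet> y) powr (\<alpha> / 2)"
    unfolding eq using assms by (intro powr_mono2) auto
  define T where "T = y \<bullet> y"
  have T: "T \<ge> 0" by (simp add: T_def)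
  define w where "w = (1 + T) powr (\<alpha> / 2 - 1)"
  have w: "w \<le> 1" unfolding w_def using powr_mono2'[of "\<alpha> / 2 - 1" 1 "1 + T"] T assms by simp
  have "(1 + T) powr (\<alpha> / 2) = w * (1 + T)"
    using T by (simp add: w_def powr_diff)
  moreover have "T * w \<le> T powr (\<alpha> / 2)"
  \<comment> \<open>At \<open>T = 0\<close> the comparison of \<open>w\<close> with
    \<open>T powr (\<alpha> / 2 - 1)\<close> fails, since \<open>0 powr\<close> anything is 0 while
    \<open>w = 1\<close>; but there \<open>T * w\<close> vanishes.\<close>
  proof (cases "T = 0")
    case False
    have "w \<le> T powr (\<alpha> / 2 - 1)"
      unfolding w_def using False T assms by (intro powr_mono2') auto
    then have "T * w \<le> T * T powr (\<alpha> / 2 - 1)" using T by (intro mult_left_mono)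
    also have "\<dots> = T powr (\<alpha> / 2)" using False T by (simp add: powr_diff)
    finally show ?thesis .
  qed simp
  ultimately show "(1 + y \<bullet> y) powr (\<alpha> / 2) \<le> norm y powr \<alpha> + 1"
    unfolding eq T_def[symmetric] using w by (simp add: algebra_simps)
qed

section \<open>Counting lattice points along parallel progressions\<close>

lemma card_int_le_diameter:
  fixes T :: "int set" and L :: real
  assumes "finite T" "0 \<le> L" and "\<And>i j. i \<in> T \<Longrightarrow> j \<in> T \<Longrightarrow> i < j \<Longrightarrow> real_of_int (j - i) \<le> L"
  shows "real (card T) \<le> L + 1"
proof (cases "T = {}")
  case False
  have MM: "Min T \<in> T" "Max T \<in> T" "Min T \<le> Max T"
    using False assms(1) by auto
  have "T \<subseteq> {Min T..Max T}" using assms(1) by auto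
  then have "card T \<le> nat (Max T - Min T + 1)"
    using card_mono[of "{Min T..Max T}" T] by simp
  moreover have "real_of_int (Max T - Min T) \<le> L"
    using assms(2,3)[of] MM by (cases "Min T = Max T") auto
  ultimately show ?thesis using MM by linarith
qed (use assms in auto)

text \<open>The set is cut into progressions with step \<open>(v1, v2)\<close>. The determinant with
  \<open>v\<close> selects a line and takes at most \<open>2 * K + 1\<close> values; the residue
  modulo \<open>Q\<close> selects a progression on that line. By \<open>gap\<close>, each
  progression meets \<open>A\<close> in at most \<open>L + 1\<close> points.\<close>

lemma card_le_lattice_lines:
  fixes A :: "lattice set" and v1 v2 :: int and L R :: real
  defines "Q \<equiv> v1\<^sup>2 + v2\<^sup>2"
  assumes A: "finite A" "\<And>x. x \<in> A \<Longrightarrow> lnorm x \<le> R" and R: "0 \<le> R" and Q: "Q > 0" and L: "0 \<le> L"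
    and gap: "\<And>x1 x2 n. (x1, x2) \<in> A \<Longrightarrow> n > 0 \<Longrightarrow>
      (x1 + n * v1, x2 + n * v2) \<in> A \<Longrightarrow> real_of_int n \<le> L"
  shows "real (card A) \<le> (2 * (lnorm (v1, v2) * R) + 1) * real_of_int Q * (L + 1)"
proof -
  define dt dot where "dt x = v1 * snd x - v2 * fst x"
    and "dot x = v1 * fst x + v2 * snd x" for x :: lattice
  define c where "c x = (dt x, dot x mod Q)" for x
  define K where "K = \<lfloor>lnorm (v1, v2) * R\<rfloor>"
  have K: "K \<ge> 0" using R by (simp add: K_def lnorm_def)
  \<comment> \<open>As \<open>Q x = (x \<bullet> v) v + det (v, x) (- v2, v1)\<close>, points with the same \<open>c\<close> differ by an integer multiple of \<open>v\<close>.\<close>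
  have rec1: "Q * fst x = dot x * v1 - dt x * v2" for x
    by (simp add: Q_def dt_def dot_def power2_eq_square algebra_simps)
  have rec2: "Q * snd x = dot x * v2 + dt x * v1" for x
    by (simp add: Q_def dt_def dot_def power2_eq_square algebra_simps)
  have "c ` A \<subseteq> {-K..K} \<times> {0..<Q}"
  proof
    fix p assume "p \<in> c ` A"
    then obtain x where x: "x \<in> A" "p = c x" by blast
    \<comment> \<open>The determinant is an inner product with the rotated vector
      \<open>(- v2, v1)\<close>, which is as long as \<open>v\<close>.\<close>
    have "\<bar>(real_of_int (- v2), real_of_int v1) \<bullet> (real_of_int (fst x), real_of_int (snd x))\<bar>
        \<le> norm (real_of_int (- v2), real_of_int v1) * norm (real_of_int (fst x), real_of_int (snd x))"
      by (rule Cauchy_Schwarz_ineq2)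
    also have "\<dots> = lnorm (v1, v2) * lnorm x"
      by (simp add: lnorm_def norm_Pair add.commute)
    also have "\<dots> \<le> lnorm (v1, v2) * R"
      using A(2) x by (intro mult_left_mono) (auto simp: lnorm_def)
    finally have "\<bar>real_of_int (dt x)\<bar> \<le> lnorm (v1, v2) * R"
      by (simp add: dt_def)
    then have "\<bar>dt x\<bar> \<le> K" unfolding K_def by linarith
    then show "p \<in> {-K..K} \<times> {0..<Q}"
      using Q x by (auto simp: c_def)
  qed
  then have "card (c ` A) \<le> card ({-K..K} \<times> {0..<Q})" by (intro card_mono) auto
  also have "\<dots> = nat (2 * K + 1) * nat Q" by (simp add: card_cartesian_product)
  finally have "real (card (c ` A)) \<le> real (nat (2 * K + 1) * nat Q)"
    by (simp only: of_nat_le_iff)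
  also have "\<dots> = real_of_int (2 * K + 1) * real_of_int Q" using K Q by simp
  also have "\<dots> \<le> (2 * (lnorm (v1, v2) * R) + 1) * real_of_int Q"
    using Q unfolding K_def by (intro mult_right_mono) (linarith, simp)
  finally have card_c: "real (card (c ` A)) \<le> (2 * (lnorm (v1, v2) * R) + 1) * real_of_int Q" .
  have fibre: "real (card {x \<in> A. c x = p}) \<le> L + 1" for p
  proof -
    let ?T = "{x \<in> A. c x = p}"
    \<comment> \<open>\<open>D\<close> is the position along the progression: for equal residues,
      \<open>dot\<close> changes by exactly \<open>Q\<close> times the change of \<open>D\<close>,
      and \<open>Q\<close> cancels from \<open>rec1\<close> and \<open>rec2\<close>.\<close>
    define D where "D x = dot x div Q" for x
    have shift: "fst x' = fst x + (D x' - D x) * v1 \<and> snd x' = snd x + (D x' - D x) * v2"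
      if "c x = c x'" for x x'
    proof -
      have dd: "dt x' = dt x" "dot x mod Q = dot x' mod Q" using that by (auto simp: c_def)
      have "dot x' = Q * D x' + dot x' mod Q" "dot x = Q * D x + dot x mod Q"
        by (simp_all add: D_def)
      then have dot: "dot x' = dot x + Q * (D x' - D x)"
        unfolding dd by (simp add: algebra_simps)
      have "Q * fst x' = Q * (fst x + (D x' - D x) * v1)"
        by (simp only: distrib_left rec1 dd dot) (simp add: algebra_simps)
      moreover have "Q * snd x' = Q * (snd x + (D x' - D x) * v2)"
        by (simp only: distrib_left rec2 dd dot) (simp add: algebra_simps)
      ultimately show ?thesis using Q by simp
    qed
    have "inj_on D ?T"
    proof (rule inj_onI)
      fix x y assume "x \<in> ?T" "y \<in> ?T" "D x = D y"
      then show "x = y" using shift[of x y] by (auto simp: prod_eq_iff)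
    qed
    then have "card ?T = card (D ` ?T)" by (simp add: card_image)
    moreover have "real (card (D ` ?T)) \<le> L + 1"
    proof (rule card_int_le_diameter)
      fix i j assume "i \<in> D ` ?T" "j \<in> D ` ?T" and ij: "i < j"
      then obtain x y where xy: "x \<in> A" "y \<in> A" "c x = p" "c y = p" "i = D x" "j = D y" by auto
      have "(fst x + (j - i) * v1, snd x + (j - i) * v2) = y"
        using shift[of x y] xy by (simp add: prod_eq_iff)
      then show "real_of_int (j - i) \<le> L"
        using gap[of "fst x" "snd x" "j - i"] xy(1,2) ij by simp
    qed (use A L in auto)
    ultimately show ?thesis by simp
  qed
  have "real (card A) = (\<Sum>x\<in>A. 1)" by simp
  also have "\<dots> = (\<Sum>p\<in>c ` A. \<Sum>x\<in>{x \<in> A. c x = p}. 1)"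
    using A by (intro sum.image_gen) auto
  also have "\<dots> \<le> (\<Sum>p\<in>c ` A. L + 1)"
    using fibre by (intro sum_mono) simp
  also have "\<dots> = real (card (c ` A)) * (L + 1)" by simp
  also have "\<dots> \<le> (2 * (lnorm (v1, v2) * R) + 1) * real_of_int Q * (L + 1)"
    using card_c L by (intro mult_right_mono) auto
  finally show ?thesis .
qed

section \<open>The count for one free frequency\<close>

lemma bracket_pos: "0 < bracket a"
proof -
  have "1 + (lnorm a)\<^sup>2 > 0" by (simp add: add_pos_nonneg)
  then show ?thesis by (simp add: bracket_def)
qed

text \<open>Each step by \<open>v\<close> raises the smoothed difference by at least
  \<open>\<delta>\<close>, while its values stay in a window of width \<open>2 * B + 2\<close>. So a
  progression holds at most \<open>L + 1\<close> points, and there are \<open>O(R)\<close>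
  progressions.\<close>

lemma card_difference_window:
  fixes a :: lattice and \<alpha> B R m :: real
  assumes \<alpha>: "1 < \<alpha>" "\<alpha> < 2" and B: "0 \<le> B" and a: "a \<noteq> 0" and R: "1 \<le> R"
  defines "A \<equiv> {x. lnorm x \<le> R \<and> \<bar>lnorm x powr \<alpha> - lnorm (x - a) powr \<alpha> - m\<bar> \<le> B}"
  shows "real (card A)
    \<le> 28 * (3 / (\<alpha> - 1) + 2) ^ 3 * (B + 1) * (R powr (3 - \<alpha>) / bracket a + R)"
proof -
  define e :: "lattice \<Rightarrow> real \<times> real" where "e x = (real_of_int (fst x), real_of_int (snd x))" for x
  have lnorm_e: "lnorm x = norm (e x)" for x by (simp add: lnorm_def e_def)
  have e_diff: "e (x - y) = e x - e y" for x y by (simp add: e_def)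
  have e_add: "e (x1 + n * v1, x2 + n * v2) = e (x1, x2) + real_of_int n *\<^sub>R e (v1, v2)" for x1 x2 n v1 v2
    by (simp add: e_def)
  define M where "M = 3 / (\<alpha> - 1)"
  have M: "M \<ge> 3" using \<alpha> by (simp add: M_def pos_le_divide_eq)
  define w where "w = (M / norm (e a)) *\<^sub>R e a"
  define v1 v2 where "v1 = round (fst w)" and "v2 = round (snd w)"
  define v where "v = e (v1, v2)"
  define u where "u = v - w"
  have na: "1 \<le> norm (e a)"
  proof -
    have "1 \<le> (fst a)\<^sup>2 + (snd a)\<^sup>2"
      using a by (simp add: prod_eq_iff) (smt (verit) sum_power2_gt_zero_iff)
    then have "1 \<le> (real_of_int (fst a))\<^sup>2 + (real_of_int (snd a))\<^sup>2"
      by (metis of_int_1_le_iff of_int_add of_int_power)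
    then show ?thesis by (simp add: e_def norm_Pair)
  qed
  then have ea: "e a \<noteq> 0" by auto
  \<comment> \<open>Rounding moves each coordinate by at most 1/2.\<close>
  have u: "norm u \<le> 1"
  proof -
    have "\<bar>fst u\<bar> \<le> 1/2" "\<bar>snd u\<bar> \<le> 1/2"
      using of_int_round_abs_le[of "fst w"] of_int_round_abs_le[of "snd w"]
      by (simp_all add: u_def v_def e_def v1_def v2_def)
    moreover have "norm u \<le> norm (fst u) + norm (snd u)"
      using norm_Pair_le[of "fst u" "snd u"] by simp
    ultimately show ?thesis by simp
  qed
  have v: "v = (3 / (\<alpha> - 1) / norm (e a)) *\<^sub>R e a + u"
    by (simp add: u_def w_def M_def)
  have nw: "norm w = M" using M ea by (simp add: w_def)
  have nv: "norm v \<le> M + 1" "norm v \<ge> M - 1"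
    using u nw norm_triangle_ineq[of w u] norm_triangle_ineq4[of v u] by (simp_all add: u_def)
  define Q where "Q = v1\<^sup>2 + v2\<^sup>2"
  have Qv: "real_of_int Q = (norm v)\<^sup>2"
    by (simp add: Q_def v_def e_def norm_Pair)
  \<comment> \<open>Since \<open>M \<ge> 3\<close>, rounding cannot annihilate the vector.\<close>
  have Q: "Q > 0"
  proof -
    have "norm v > 0" using nv M by linarith
    then have "real_of_int Q > 0" unfolding Qv by simp
    then show ?thesis by simp
  qed
  define \<delta> where "\<delta> = norm (e a) * (R + norm (e a) + 1) powr (\<alpha> - 2)"
  define L where "L = (2 * B + 2) / \<delta>"
  have \<rho>: "R + norm (e a) + 1 > 0" using R na by linarith
  have \<delta>: "\<delta> > 0" unfolding \<delta>_def using \<rho> ea by simp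
  have L: "L \<ge> 0" using B \<delta> by (simp add: L_def)
  have fin: "finite A" unfolding A_def by (rule finite_subset[OF _ finite_lnorm_le[of R]]) auto
  define G where "G y = (1 + y \<bullet> y) powr (\<alpha> / 2)" for y :: "real \<times> real"
  \<comment> \<open>Both smoothing errors lie between 0 and 1 and they enter with opposite signs, so
    only 1 is added to \<open>B\<close>.\<close>
  have window: "\<bar>G (e x) - G (e x - e a) - m\<bar> \<le> B + 1" if "x \<in> A" for x
  proof -
    have "\<bar>norm (e x) powr \<alpha> - norm (e x - e a) powr \<alpha> - m\<bar> \<le> B"
      using that by (simp add: A_def lnorm_e e_diff)
    then show ?thesis
      using powr_bracket_diff_bounds[of \<alpha> "e x"] powr_bracket_diff_bounds[of \<alpha> "e x - e a"] \<alpha>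
      unfolding G_def by linarith
  qed
  have gap: "real_of_int n \<le> L"
    if x: "(x1, x2) \<in> A" "(x1 + n * v1, x2 + n * v2) \<in> A" and n: "n > 0" for x1 x2 n
  proof -
    let ?x = "e (x1, x2)" and ?n = "real_of_int n"
    have "norm ?x \<le> R" "norm (?x + ?n *\<^sub>R v) \<le> R"
      using x by (simp_all add: A_def lnorm_e e_add v_def)
    then have "?n * \<delta> \<le> (G (?x + ?n *\<^sub>R v) - G (?x - e a + ?n *\<^sub>R v)) - (G ?x - G (?x - e a))"
      using bracket_difference_growth[OF \<alpha> ea u v, of 0 "real_of_int n" ?x R] n
      by (simp add: \<delta>_def G_def)
    also have "\<dots> \<le> 2 * B + 2"
      using window[OF x(1)] window[OF x(2)] by (simp add: e_add v_def[symmetric] algebra_simps)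
    finally show ?thesis using \<delta> by (simp add: L_def pos_le_divide_eq)
  qed
  have "real (card A) \<le> (2 * (lnorm (v1, v2) * R) + 1) * real_of_int (v1\<^sup>2 + v2\<^sup>2) * (L + 1)"
    using Q gap L fin R by (intro card_le_lattice_lines) (auto simp: Q_def A_def)
  also have "\<dots> \<le> (2 * (M + 2) * R) * (M + 2)\<^sup>2 * (12 * (B + 1) * (R powr (2 - \<alpha>) / bracket a) + 7 * (B + 1))"
  proof (intro mult_mono)
    show "2 * (lnorm (v1, v2) * R) + 1 \<le> 2 * (M + 2) * R"
    proof -
      have "norm v * R \<le> (M + 1) * R" using nv R by (intro mult_right_mono) auto
      then show ?thesis using R by (simp add: lnorm_e v_def[symmetric] algebra_simps)
    qed
    show "real_of_int (v1\<^sup>2 + v2\<^sup>2) \<le> (M + 2)\<^sup>2"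
      unfolding Q_def[symmetric] Qv using nv M by (intro power_mono) auto
    show "L + 1 \<le> 12 * (B + 1) * (R powr (2 - \<alpha>) / bracket a) + 7 * (B + 1)"
    proof -
      \<comment> \<open>No ordering of \<open>R\<close> and \<open>norm (e a)\<close> is assumed.
        After division by \<open>norm (e a)\<close>, the contribution of \<open>R\<close> gives the
        decaying term and that of \<open>norm (e a)\<close> a constant, because
        \<open>2 - \<alpha> < 1 \<le> norm (e a)\<close>.\<close>
      define X where "X = max R (norm (e a))"
      have X: "R + norm (e a) + 1 \<le> 3 * X" "X \<ge> 1" using R by (auto simp: X_def)
      have "(R + norm (e a) + 1) powr (2 - \<alpha>) \<le> (3 * X) powr (2 - \<alpha>)"
        using X \<rho> \<alpha> by (intro powr_mono2) auto
      also have "\<dots> = 3 powr (2 - \<alpha>) * X powr (2 - \<alpha>)" using X by (simp add: powr_mult)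
      also have "\<dots> \<le> 3 powr 1 * X powr (2 - \<alpha>)"
        using \<alpha> by (intro mult_right_mono powr_mono) auto
      also have "X powr (2 - \<alpha>) \<le> R powr (2 - \<alpha>) + norm (e a) powr (2 - \<alpha>)"
        by (auto simp: X_def max_def)
      also have "norm (e a) powr (2 - \<alpha>) \<le> norm (e a) powr 1"
        using na \<alpha> by (intro powr_mono) auto
      finally have "(R + norm (e a) + 1) powr (2 - \<alpha>) \<le> 3 * (R powr (2 - \<alpha>) + norm (e a))"
        using na by simp
      moreover have "L = (2 * B + 2) * ((R + norm (e a) + 1) powr (2 - \<alpha>) / norm (e a))"
        unfolding L_def \<delta>_def using powr_minus_divide[of "R + norm (e a) + 1" "2 - \<alpha>"] by simp
      ultimately have "L \<le> (2 * B + 2) * (3 * (R powr (2 - \<alpha>) + norm (e a)) / norm (e a))"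
        using B na by (auto intro!: mult_left_mono divide_right_mono)
      also have "\<dots> = 6 * (B + 1) * (R powr (2 - \<alpha>) / norm (e a)) + 6 * (B + 1)"
        using ea by (simp add: field_simps)
      finally have L_le: "L \<le> 6 * (B + 1) * (R powr (2 - \<alpha>) / norm (e a)) + 6 * (B + 1)" .
      have "bracket a \<le> 2 * norm (e a)"
      proof -
        have "1 + (norm (e a))\<^sup>2 \<le> (2 * norm (e a))\<^sup>2"
          using one_le_power[OF na, of 2] by (simp add: power_mult_distrib)
        then have "sqrt (1 + (norm (e a))\<^sup>2) \<le> 2 * norm (e a)"
          by (intro real_le_lsqrt) auto
        then show ?thesis by (simp add: bracket_def powr_half_sqrt lnorm_e)
      qed
      then have "R powr (2 - \<alpha>) / norm (e a) \<le> R powr (2 - \<alpha>) / (bracket a / 2)"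
        using na bracket_pos[of a] ea by (intro divide_left_mono mult_pos_pos) auto
      then have "6 * (B + 1) * (R powr (2 - \<alpha>) / norm (e a)) \<le> 6 * (B + 1) * (R powr (2 - \<alpha>) / (bracket a / 2))"
        using B by (intro mult_left_mono) auto
      also have "\<dots> = 12 * (B + 1) * (R powr (2 - \<alpha>) / bracket a)" by simp
      finally show ?thesis using L_le B by (simp only: distrib_left distrib_right)
    qed
  qed (use R M L Q in \<open>auto simp: Q_def[symmetric]\<close>)
  also have "\<dots> = 2 * (M + 2) ^ 3 * (B + 1) * (12 * (R powr (3 - \<alpha>) / bracket a) + 7 * R)"
  proof -
    have "R powr (3 - \<alpha>) = R * R powr (2 - \<alpha>)"
      using R powr_add[of R 1 "2 - \<alpha>"] by simp
    then show ?thesis by (simp add: power2_eq_square power3_eq_cube algebra_simps)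
  qed
  also have "\<dots> \<le> 28 * (M + 2) ^ 3 * (B + 1) * (R powr (3 - \<alpha>) / bracket a + R)"
  proof -
    define X P where "X = R powr (3 - \<alpha>) / bracket a" and "P = (M + 2) ^ 3 * (B + 1)"
    have "0 \<le> X" "0 \<le> P" using bracket_pos[of a] M B by (simp_all add: X_def P_def)
    \<comment> \<open>Both coefficients are raised to 14; with the factor 2 this gives 28.\<close>
    then have "P * (12 * X + 7 * R) \<le> P * (14 * X + 14 * R)"
      using R by (intro mult_left_mono) auto
    then have "2 * P * (12 * X + 7 * R) \<le> 28 * P * (X + R)" by (simp add: algebra_simps)
    then show ?thesis by (simp add: X_def P_def mult.assoc)
  qed
  finally show ?thesis unfolding M_def .
qed

section \<open>Reduction of the four estimates to the count\<close>

text \<open>\<open>f\<close> reads off the free frequency and \<open>g\<close> rebuilds the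
  quadruple from it, so \<open>f\<close> is injective on \<open>S\<close>. Asking for
  \<open>a \<noteq> 0\<close> only in the presence of a member covers prescribed frequencies that
  coincide, where \<open>S\<close> is empty.\<close>

lemma card_le_difference_window:
  fixes S :: "'b set" and f :: "'b \<Rightarrow> lattice" and g :: "lattice \<Rightarrow> 'b"
  assumes "1 < \<alpha>" "\<alpha> < 2" "0 \<le> B" "1 \<le> R"
    and S: "\<And>s. s \<in> S \<Longrightarrow> s = g (f s) \<and> a \<noteq> 0 \<and> lnorm (f s) \<le> R \<and>
      \<bar>lnorm (f s) powr \<alpha> - lnorm (f s - a) powr \<alpha> - m\<bar> \<le> B"
  shows "real (card S)
    \<le> 28 * (3 / (\<alpha> - 1) + 2) ^ 3 * (B + 1) * (R powr (3 - \<alpha>) / bracket a + R)"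
proof (cases "S = {}")
  case True
  then show ?thesis using assms(1-4) bracket_pos[of a] by (simp add: less_imp_le)
next
  case False
  then have a: "a \<noteq> 0" using S by blast
  let ?A = "{x. lnorm x \<le> R \<and> \<bar>lnorm x powr \<alpha> - lnorm (x - a) powr \<alpha> - m\<bar> \<le> B}"
  have "inj_on f S" using S by (intro inj_on_inverseI[of _ g]) auto
  moreover have "f ` S \<subseteq> ?A" using S by blast
  moreover have "finite ?A" by (rule finite_subset[OF _ finite_lnorm_le[of R]]) auto
  ultimately have "card S \<le> card ?A" by (rule card_inj_on_le)
  then have "real (card S) \<le> real (card ?A)" by simp
  also note card_difference_window[OF assms(1-3) a assms(4)]
  finally show ?thesis .
qed

lemma bracket_minus_commute: "bracket (x - y) = bracket (y - x)"
  by (simp add: bracket_def lnorm_def norm_Pair power2_commute)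

theorem lemma4p5:
  fixes \<alpha> B :: real
  assumes "1 < \<alpha>" and "\<alpha> < 2" and "0 \<le> B"
  shows "\<exists>C>0. \<forall>N N1 N2 N3 m :: real.
    dyadic N \<and> dyadic N1 \<and> dyadic N2 \<and> dyadic N3 \<and>
    1 \<le> N1 \<and> N1 \<le> N \<and> 1 \<le> N2 \<and> N2 \<le> N \<and> 1 \<le> N3 \<and> N3 \<le> N \<longrightarrow>
    (let S = res_set \<alpha> B m N N1 N2 N3 in
      (\<forall>k k1. real (card {(l, l1, l2, l3) \<in> S. l = k \<and> l1 = k1})
        \<le> C * (min N2 N3 powr (3 - \<alpha>) / bracket (k - k1) + min N2 N3)) \<and>
      (\<forall>k k3. real (card {(l, l1, l2, l3) \<in> S. l = k \<and> l3 = k3})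
        \<le> C * (min N1 N2 powr (3 - \<alpha>) / bracket (k - k3) + min N1 N2)) \<and>
      (\<forall>k1 k2. real (card {(l, l1, l2, l3) \<in> S. l1 = k1 \<and> l2 = k2})
        \<le> C * (N3 powr (3 - \<alpha>) / bracket (k1 - k2) + N3)) \<and>
      (\<forall>k2 k3. real (card {(l, l1, l2, l3) \<in> S. l2 = k2 \<and> l3 = k3})
        \<le> C * (N1 powr (3 - \<alpha>) / bracket (k2 - k3) + N1)))"
proof -
  \<comment> \<open>Depends on \<open>\<alpha>\<close> and \<open>B\<close> only, hence is uniform
    in the radii, \<open>m\<close> and the prescribed frequencies.\<close>
  define C where "C = 28 * (3 / (\<alpha> - 1) + 2) ^ 3 * (B + 1)"
  have C: "C > 0"
    unfolding C_def using assms by (intro mult_pos_pos zero_less_power add_pos_pos add_nonneg_pos) auto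
  note bound = card_le_difference_window[OF assms, folded C_def]
  have est: "real (card {(l, l1, l2, l3) \<in> S. l = k \<and> l1 = k1})
        \<le> C * (min N2 N3 powr (3 - \<alpha>) / bracket (k - k1) + min N2 N3)" (is ?t1)
     "real (card {(l, l1, l2, l3) \<in> S. l = k \<and> l3 = k3})
        \<le> C * (min N1 N2 powr (3 - \<alpha>) / bracket (k - k3) + min N1 N2)" (is ?t2)
     "real (card {(l, l1, l2, l3) \<in> S. l1 = k1 \<and> l2 = k2})
        \<le> C * (N3 powr (3 - \<alpha>) / bracket (k1 - k2) + N3)" (is ?t3)
     "real (card {(l, l1, l2, l3) \<in> S. l2 = k2 \<and> l3 = k3})
        \<le> C * (N1 powr (3 - \<alpha>) / bracket (k2 - k3) + N1)" (is ?t4)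
    if N: "1 \<le> N1" "1 \<le> N2" "1 \<le> N3" and S: "S = res_set \<alpha> B m N N1 N2 N3"
    for N N1 N2 N3 m S k k1 k2 k3
  proof -
    let ?p = "\<lambda>x. lnorm x powr \<alpha>"
    let ?Q = "\<lambda>l l1 l2 l3. l2 \<noteq> l1 \<and> l2 \<noteq> l3 \<and> l \<noteq> l1 \<and> l1 \<noteq> l \<and> l \<noteq> l3 \<and> l3 \<noteq> l \<and>
        \<bar>?p l1 - ?p l2 + ?p l3 - ?p l - m\<bar> \<le> B \<and> lnorm l1 \<le> N1 \<and> lnorm l2 \<le> N2 \<and> lnorm l3 \<le> N3"
    \<comment> \<open>The linear relation solved in the six ways used below, in that order. It also
      gives \<open>l - l1 = l3 - l2\<close> and \<open>l - l3 = l1 - l2\<close>, so the exclusion of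
      \<open>l2\<close> from \<open>{l1, l3}\<close> makes every shift \<open>a\<close>
      nonzero.\<close>
    have res: "l2 - (l1 - l) = l3 \<and> ?Q l l1 l2 l3" "l3 - (l - l1) = l2 \<and> ?Q l l1 l2 l3"
        "l1 - (l - l3) = l2 \<and> ?Q l l1 l2 l3" "l2 - (l3 - l) = l1 \<and> ?Q l l1 l2 l3"
        "l3 - (l2 - l1) = l \<and> ?Q l l1 l2 l3" "l1 - (l2 - l3) = l \<and> ?Q l l1 l2 l3"
      if "(l, l1, l2, l3) \<in> S" for l l1 l2 l3
      using that by (auto simp: S res_set_def algebra_simps)
    show ?t1
    \<comment> \<open>The free point is the frequency with the smaller radius. Choosing
      \<open>l2\<close>, which enters with a minus sign, reverses the sign of the window centre and
      of the shift; \<open>bracket\<close> is even.\<close>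
    proof (cases "N2 \<le> N3")
      case True
      show ?thesis
        unfolding min_absorb1[OF True] bracket_minus_commute[of k k1]
        by (rule bound[where f = "\<lambda>(l, l1, l2, l3). l2"
            and g = "\<lambda>x. (k, k1, x, x - (k1 - k))" and a = "k1 - k" and m = "?p k1 - ?p k - m"],
            use N in simp)
          (elim CollectE case_prodE conjE, hypsubst, drule res(1), simp; linarith)
    next
      case False
      then have le: "N3 \<le> N2" by simp
      show ?thesis
        unfolding min_absorb2[OF le]
        by (rule bound[where f = "\<lambda>(l, l1, l2, l3). l3"
            and g = "\<lambda>x. (k, k1, x - (k - k1), x)" and a = "k - k1" and m = "m + ?p k - ?p k1"],
            use N in simp)
          (elim CollectE case_prodE conjE, hypsubst, drule res(2), simp; linarith)
    qed
    show ?t2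
    proof (cases "N1 \<le> N2")
      case True
      show ?thesis
        unfolding min_absorb1[OF True]
        by (rule bound[where f = "\<lambda>(l, l1, l2, l3). l1"
            and g = "\<lambda>x. (k, x, x - (k - k3), k3)" and a = "k - k3" and m = "m + ?p k - ?p k3"],
            use N in simp)
          (elim CollectE case_prodE conjE, hypsubst, drule res(3), simp; linarith)
    next
      case False
      then have le: "N2 \<le> N1" by simp
      show ?thesis
        unfolding min_absorb2[OF le] bracket_minus_commute[of k k3]
        by (rule bound[where f = "\<lambda>(l, l1, l2, l3). l2"
            and g = "\<lambda>x. (k, x - (k3 - k), x, k3)" and a = "k3 - k" and m = "?p k3 - ?p k - m"],
            use N in simp)
          (elim CollectE case_prodE conjE, hypsubst, drule res(4), simp; linarith)
    qed
    \<comment> \<open>Here \<open>l3\<close> and \<open>l\<close> vary; taking \<open>l3\<close> as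
      the free point gives the radius \<open>N3\<close>.\<close>
    show ?t3
      unfolding bracket_minus_commute[of k1 k2]
      by (rule bound[where f = "\<lambda>(l, l1, l2, l3). l3"
            and g = "\<lambda>x. (x - (k2 - k1), k1, k2, x)" and a = "k2 - k1" and m = "m + ?p k2 - ?p k1"],
            use N in simp)
          (elim CollectE case_prodE conjE, hypsubst, drule res(5), simp; linarith)
    show ?t4
      by (rule bound[where f = "\<lambda>(l, l1, l2, l3). l1"
            and g = "\<lambda>x. (x - (k2 - k3), x, k2, k3)" and a = "k2 - k3" and m = "m + ?p k2 - ?p k3"],
            use N in simp)
          (elim CollectE case_prodE conjE, hypsubst, drule res(6), simp; linarith)
  qed
  show ?thesis
    unfolding Let_def
    by (intro exI[of _ C] conjI allI impI C; elim conjE; rule est[OF _ _ _ refl]; assumption)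
qed

end
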